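(* Let $\mathcal{A},\mathcal{B}\in T_{m,n}$ be such that $(\mathcal{A},\mathcal{B})$ is a generalized $\mathcal{M}$-tensor pair, and let $\{\rho_k\}$, $\{\mathbf{x}_k\}$, $\{\mathbf{y}_k\}$ be generated by the Generalized Newton-Noda Iteration (GNNI), where for a fixed $\eta>0$ and a fixed $\xi>0$ the step sizes satisfy $\theta_k\in[\xi,1]$ and $$\mathbf{h}_k(\theta_k)\ge\frac{\theta_k\,\mathcal{B}\mathbf{x}_k^{m-1}}{(1+\eta)\|\mathbf{w}_k\|}\quad\text{for all }k\ge 0.$$ Then the monotonically decreasing sequence $\{\rho_k\}$ converges to $\lambda$, and $\{\mathbf{x}_k\}$ converges to $\mathbf{x}_*$. Moreover, $\{\mathbf{y}_k\}$ converges to $\mathbf{x}_*$ as well. Here $\lambda$ is the unique positive generalized eigenvalue of $(\mathcal{A},\mathcal{B})$ with a positive generalized eigenvector, and $\mathbf{x}_*>0$, $\|\mathbf{x}_*\|=1$, is the corresponding positive eigenvector.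
   Context: Let $m,n\ge 2$. $T_{m,n}$ is the set of real tensors $\mathcal{A}=(a_{i_1\ldots i_m})$ with $i_1,\ldots,i_m\in\{1,\ldots,n\}$. For $\mathbf{x}\in\mathbb{R}^n$, $(\mathcal{A}\mathbf{x}^{m-1})_i=\sum_{i_2,\ldots,i_m} a_{ii_2\cdots i_m}x_{i_2}\cdots x_{i_m}$ and $\mathcal{A}\mathbf{x}^{m-2}$ is the $n\times n$ matrix $(\mathcal{A}\mathbf{x}^{m-2})_{ij}=\sum_{i_3,\ldots,i_m} a_{iji_3\cdots i_m}x_{i_3}\cdots x_{i_m}$. Inequalities are entrywise; $\frac{\mathbf{x}}{\mathbf{y}}$ is the entrywise quotient; $\max\mathbf{x}$, $\min\mathbf{x}$ are the largest and smallest entries; $\|\cdot\|$ is the 2-norm. A number $t$ is a generalized eigenvalue of $(\mathcal{A},\mathcal{B})$ with generalized eigenvector $\mathbf{x}\ne\mathbf{0}$ if $\mathcal{A}\mathbf{x}^{m-1}=t\mathcal{B}\mathbf{x}^{m-1}$. $\mathcal{A}$ is weakly irreducible if for every nonempty proper subset $S\subset\{1,\ldots,n\}$ there exist $i_1\in S$ and $i_2,\ldots,i_m$ with at least one $i_q\notin S$ ($2\le q\le m$) such that $a_{i_1i_2\ldots i_m}\ne0$. $(\mathcal{A},\mathcal{B})$ is a generalized $\mathcal{M}$-tensor pair if: (1) $\mathcal{A}\ge 0$; (2) $\mathcal{A}$ is weakly irreducible; (3) there is $\mathbf{v}>0$ with $\mathcal{B}\mathbf{v}^{m-1}>\mathcal{A}\mathbf{v}^{m-1}$;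 (4) $b_{ii_2\ldots i_m}\le a_{ii_2\ldots i_m}$ for all $i$ and all $(i_2,\ldots,i_m)\ne(i,\ldots,i)$. Standing assumption: $\mathcal{A}$ and $\mathcal{B}$ are semisymmetric, i.e. $a_{ii_2\ldots i_m}$ and $b_{ii_2\ldots i_m}$ are invariant under permutations of $i_2,\ldots,i_m$. GNNI: fix $\mathbf{b}>0$. Let $\mathbf{x}_0=\hat{\mathbf{x}}/\|\hat{\mathbf{x}}\|$, where $\hat{\mathbf{x}}$ is the unique positive solution of $(\mathcal{B}-\mathcal{A})\hat{\mathbf{x}}^{m-1}=\mathbf{b}$, and $\rho_0=\max\frac{\mathcal{A}\mathbf{x}_0^{m-1}}{\mathcal{B}\mathbf{x}_0^{m-1}}$. For $k=0,1,2,\ldots$: $\mathbf{w}_k$ solves $(m-1)(\rho_k\mathcal{B}-\mathcal{A})\mathbf{x}_k^{m-2}\,\mathbf{w}_k=\mathcal{B}\mathbf{x}_k^{m-1}$; $\mathbf{y}_k=\mathbf{w}_k/\|\mathbf{w}_k\|$; $\tilde{\mathbf{x}}_{k+1}=(m-2)\mathbf{x}_k+\theta_k\mathbf{y}_k$ with $\theta_k\in(0,1]$ such that $(\mathcal{B}-\mathcal{A})\tilde{\mathbf{x}}_{k+1}^{m-1}>0$; $\mathbf{x}_{k+1}=\tilde{\mathbf{x}}_{k+1}/\|\tilde{\mathbf{x}}_{k+1}\|$; $\rho_{k+1}=\max\frac{\mathcal{A}\mathbf{x}_{k+1}^{m-1}}{\mathcal{B}\mathbf{x}_{k+1}^{m-1}}$.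 The iteration is run without a stopping test, so the sequences are infinite and satisfy these relations for all $k\ge0$. $\mathbf{h}_k(\theta)=(\rho_k\mathcal{B}-\mathcal{A})\big((m-2)\mathbf{x}_k+\theta\mathbf{y}_k\big)^{m-1}$. *)

theory Defs
  imports "HOL-Analysis.Analysis"
begin

text \<open>
  The entry of a tensor of order \<open>m\<close> at \<open>(i\<^sub>1, \<dots>, i\<^sub>m)\<close> is its value at the list
  \<open>[i\<^sub>1, \<dots>, i\<^sub>m]\<close>. The dimension is \<open>CARD('n)\<close>. The order is an explicit
  parameter of the definitions below; values at lists of any other length are never used.
\<close>

type_synonym 'n tensor = "'n list \<Rightarrow> real"

text \<open>
  The library order \<open><\<close> on vectors is not the entrywise strict order (it is
  \<open>x \<le> y \<and> \<not> y \<le> x\<close>), whereas \<open>\<le>\<close> is entrywise.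
\<close>

definition vless :: "real ^ 'n \<Rightarrow> real ^ 'n \<Rightarrow> bool"  (infix "\<lless>" 50)
  where "x \<lless> y \<longleftrightarrow> (\<forall>i. x $ i < y $ i)"

text \<open>\<open>tvec m A x\<close> is \<open>A x\<^sup>m\<^sup>-\<^sup>1\<close>, and \<open>tmat m A x\<close> is \<open>A x\<^sup>m\<^sup>-\<^sup>2\<close>.\<close>

definition tvec :: "nat \<Rightarrow> 'n::finite tensor \<Rightarrow> real ^ 'n \<Rightarrow> real ^ 'n"
  where "tvec m A x =
    (\<chi> i. \<Sum>is | length is = m - 1. A (i # is) * (\<Prod>j\<leftarrow>is. x $ j))"

definition tmat :: "nat \<Rightarrow> 'n::finite tensor \<Rightarrow> real ^ 'n \<Rightarrow> real ^ 'n ^ 'n"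
  where "tmat m A x =
    (\<chi> i j. \<Sum>is | length is = m - 2. A (i # j # is) * (\<Prod>l\<leftarrow>is. x $ l))"

definition semisymmetric :: "nat \<Rightarrow> 'n tensor \<Rightarrow> bool"
  where "semisymmetric m A \<longleftrightarrow>
    (\<forall>i is js. length is = m - 1 \<and> mset is = mset js \<longrightarrow> A (i # is) = A (i # js))"

definition weakly_irreducible :: "nat \<Rightarrow> 'n tensor \<Rightarrow> bool"
  where "weakly_irreducible m A \<longleftrightarrow>
    (\<forall>S. S \<noteq> {} \<and> S \<noteq> UNIV \<longrightarrow>
      (\<exists>i\<in>S. \<exists>is. length is = m - 1 \<and> (\<exists>j\<in>set is. j \<notin> S) \<and> A (i # is) \<noteq> 0))"

definition generalized_M_tensor_pair :: "nat \<Rightarrow> 'n::finite tensor \<Rightarrow> 'n tensor \<Rightarrow> bool"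
  where "generalized_M_tensor_pair m A B \<longleftrightarrow>
    (\<forall>is. length is = m \<longrightarrow> 0 \<le> A is) \<and>
    weakly_irreducible m A \<and>
    (\<exists>v. 0 \<lless> v \<and> tvec m A v \<lless> tvec m B v) \<and>
    (\<forall>i is. length is = m - 1 \<and> is \<noteq> replicate (m - 1) i \<longrightarrow> B (i # is) \<le> A (i # is))"

definition generalized_eigenpair ::
    "nat \<Rightarrow> 'n::finite tensor \<Rightarrow> 'n tensor \<Rightarrow> real \<Rightarrow> real ^ 'n \<Rightarrow> bool"
  where "generalized_eigenpair m A B t x \<longleftrightarrow>
    x \<noteq> 0 \<and> tvec m A x = t *\<^sub>R tvec m B x"

text \<open>The tensor \<open>t B - A\<close>.\<close>

definition pencil :: "'n tensor \<Rightarrow> 'n tensor \<Rightarrow> real \<Rightarrow> 'n tensor"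
  where "pencil A B t = (\<lambda>is. t * B is - A is)"

definition max_ratio :: "nat \<Rightarrow> 'n::finite tensor \<Rightarrow> 'n tensor \<Rightarrow> real ^ 'n \<Rightarrow> real"
  where "max_ratio m A B x = Max (range (\<lambda>i. tvec m A x $ i / tvec m B x $ i))"

definition gnni_step :: "nat \<Rightarrow> real ^ 'n \<Rightarrow> real ^ 'n \<Rightarrow> real \<Rightarrow> real ^ 'n"
  where "gnni_step m x y s = real (m - 2) *\<^sub>R x + s *\<^sub>R y"

text \<open>
  \<open>gnni m A B b \<rho> x w y \<theta>\<close>: the infinite sequences are produced by the generalized
  Newton-Noda iteration (without stopping test) for the right-hand side \<open>b\<close>.
  The intermediate vector \<open>x\<^sub>k\<^sub>+\<^sub>1\<close> before normalization is
  \<open>gnni_step m (x k) (y k) (\<theta> k)\<close>.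
\<close>

definition gnni ::
    "nat \<Rightarrow> 'n::finite tensor \<Rightarrow> 'n tensor \<Rightarrow> real ^ 'n \<Rightarrow> (nat \<Rightarrow> real) \<Rightarrow>
     (nat \<Rightarrow> real ^ 'n) \<Rightarrow> (nat \<Rightarrow> real ^ 'n) \<Rightarrow> (nat \<Rightarrow> real ^ 'n) \<Rightarrow> (nat \<Rightarrow> real) \<Rightarrow> bool"
  where "gnni m A B b \<rho> x w y \<theta> \<longleftrightarrow>
    0 \<lless> b \<and>
    (\<exists>x'. 0 \<lless> x' \<and> tvec m (B - A) x' = b \<and> x 0 = x' /\<^sub>R norm x') \<and>
    (\<forall>k.
      \<rho> k = max_ratio m A B (x k) \<and>
      (real (m - 1) *\<^sub>R tmat m (pencil A B (\<rho> k)) (x k)) *v w k = tvec m B (x k) \<and>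
      y k = w k /\<^sub>R norm (w k) \<and>
      0 < \<theta> k \<and> \<theta> k \<le> 1 \<and>
      0 \<lless> tvec m (B - A) (gnni_step m (x k) (y k) (\<theta> k)) \<and>
      x (Suc k) = gnni_step m (x k) (y k) (\<theta> k) /\<^sub>R norm (gnni_step m (x k) (y k) (\<theta> k)))"

definition gnni_h ::
    "nat \<Rightarrow> 'n::finite tensor \<Rightarrow> 'n tensor \<Rightarrow> real \<Rightarrow> real ^ 'n \<Rightarrow> real ^ 'n \<Rightarrow> real \<Rightarrow> real ^ 'n"
  where "gnni_h m A B r x y s = tvec m (pencil A B r) (gnni_step m x y s)"

end

theory Submission
  imports Defs
begin

text \<open>
  Write \<open>P\<^sub>r\<close> for the tensor \<open>r B - A\<close>. Since \<open>P\<^sub>r = r (B - A) - (1 - r) A\<close>, for \<open>0 \<le> r < 1\<close> its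
  off-diagonal entries are nonpositive and at most \<open>- (1 - r)\<close> times those of \<open>A\<close>, so that it
  inherits weak irreducibility from \<open>A\<close>. With semisymmetry, the matrix \<open>M = P\<^sub>r x\<^sup>m\<^sup>-\<^sup>2\<close> at a
  positive \<open>x\<close> is then irreducible with nonpositive off-diagonal entries, and \<open>M x = P\<^sub>r x\<^sup>m\<^sup>-\<^sup>1\<close>,
  which is nonnegative when \<open>r\<close> is the largest ratio at \<open>x\<close>. Everything is deduced from comparing
  two vectors at an index where the quotient of their entries is extremal.

  All iterates are positive, because \<open>M x \<ge> 0\<close> and \<open>M w > 0\<close> force \<open>w > 0\<close>
  (\<open>Z_matrix_pos_solution\<close>), and the condition imposed on the step sizes says directly that
  \<open>\<rho>\<^sub>k\<close> decreases. It even bounds \<open>1 / \<parallel>w\<^sub>k\<parallel>\<close> by a constant times \<open>\<rho>\<^sub>k - \<rho>\<^sub>k\<^sub>+\<^sub>1\<close>, provided that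
  \<open>B x\<^sub>k\<^sup>m\<^sup>-\<^sup>1\<close> stays away from zero. This is where a Harnack inequality is needed: weak
  irreducibility bounds the quotients of the entries of any positive \<open>x\<close> with
  \<open>P\<^sub>r x\<^sup>m\<^sup>-\<^sup>1 \<ge> 0\<close>, uniformly for \<open>r \<le> \<rho>\<^sub>0 < 1\<close> (\<open>pencil_harnack\<close>). It cannot be replaced by
  passing to a limit, because a limit vector with zero entries may well satisfy the inequality.

  Hence \<open>\<parallel>w\<^sub>k\<parallel> \<rightarrow> \<infinity>\<close>, and the Newton equation becomes \<open>M z = 0\<close> at every limit point \<open>(u, z)\<close> of
  \<open>(x\<^sub>k, y\<^sub>k)\<close>, where \<open>M = P\<^sub>\<lambda> u\<^sup>m\<^sup>-\<^sup>2\<close>, \<open>\<lambda> = lim \<rho>\<^sub>k\<close> and \<open>u > 0\<close>. As also \<open>M u \<ge> 0\<close>,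
  irreducibility makes \<open>z\<close> a multiple of \<open>u\<close> (\<open>Z_matrix_kernel\<close>). Both are unit vectors, so
  \<open>z = u\<close>, and \<open>P\<^sub>\<lambda> u\<^sup>m\<^sup>-\<^sup>1 = M u = 0\<close>: the limit point is a positive eigenvector for \<open>\<lambda>\<close>. This
  proves in passing that an eigenpair exists. A positive unit eigenvector is unique
  (\<open>positive_eigenpair_unique\<close>), so there is only one limit point, and both sequences converge.
\<close>

section \<open>Evaluating tensors\<close>

lemma finite_index_lists [simp]: "finite {is :: 'n::finite list. length is = k}"
  using finite_lists_length_eq[of "UNIV :: 'n set" k] by simp

lemma prod_list_vec_nonneg:
  fixes x :: "real ^ 'n"
  assumes "\<And>j. 0 \<le> x $ j"
  shows "0 \<le> (\<Prod>j\<leftarrow>is. x $ j)"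
  by (induction "is") (simp_all add: assms)

lemma prod_list_vec_pos:
  fixes x :: "real ^ 'n"
  assumes "\<And>j. 0 < x $ j"
  shows "0 < (\<Prod>j\<leftarrow>is. x $ j)"
  by (induction "is") (simp_all add: assms)

lemma prod_list_vec_mono:
  fixes x y :: "real ^ 'n"
  assumes "\<And>j. 0 \<le> x $ j" and "\<And>j. x $ j \<le> y $ j"
  shows "(\<Prod>j\<leftarrow>is. x $ j) \<le> (\<Prod>j\<leftarrow>is. y $ j)"
proof (induction "is")
  case (Cons a "is")
  have "0 \<le> y $ a" using assms[of a] by linarith
  then show ?case
    using Cons assms prod_list_vec_nonneg[of x "is"] by (simp add: mult_mono)
qed simp

lemma prod_list_vec_strict_mono:
  fixes x y :: "real ^ 'n"
  assumes x: "\<And>j. 0 < x $ j" and xy: "\<And>j. x $ j \<le> y $ j"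
    and "l \<in> set is" and l: "x $ l < y $ l"
  shows "(\<Prod>j\<leftarrow>is. x $ j) < (\<Prod>j\<leftarrow>is. y $ j)"
  using \<open>l \<in> set is\<close>
proof (induction "is")
  case (Cons a "is")
  have le: "(\<Prod>j\<leftarrow>is. x $ j) \<le> (\<Prod>j\<leftarrow>is. y $ j)"
    using prod_list_vec_mono[of x y] x xy by (simp add: less_imp_le)
  show ?case
  proof (cases "a = l")
    case True
    then show ?thesis
      using l le x prod_list_vec_pos[of x "is"] by (simp add: mult_less_le_imp_less less_imp_le)
  next
    case False
    then have "(\<Prod>j\<leftarrow>is. x $ j) < (\<Prod>j\<leftarrow>is. y $ j)" using Cons by auto
    then show ?thesis
      using xy x prod_list_vec_pos[of x "is"] by (simp add: mult_le_less_imp_less less_imp_le)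
  qed
qed simp

lemma prod_list_vec_scaleR:
  fixes x :: "real ^ 'n"
  shows "(\<Prod>j\<leftarrow>is. (c *\<^sub>R x) $ j) = c ^ length is * (\<Prod>j\<leftarrow>is. x $ j)"
  by (induction "is") simp_all

lemma tendsto_prod_list_vec [tendsto_intros]:
  fixes X :: "'a \<Rightarrow> real ^ 'n"
  assumes "(X \<longlongrightarrow> u) F"
  shows "((\<lambda>k. \<Prod>j\<leftarrow>is. X k $ j) \<longlongrightarrow> (\<Prod>j\<leftarrow>is. u $ j)) F"
  by (induction "is") (auto intro!: tendsto_intros assms)

lemma tendsto_tvec [tendsto_intros]:
  fixes A :: "'n::finite tensor"
  assumes "(X \<longlongrightarrow> u) F"
  shows "((\<lambda>k. tvec m A (X k)) \<longlongrightarrow> tvec m A u) F"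
  unfolding tvec_def by (intro tendsto_intros assms)

lemma tendsto_tmat [tendsto_intros]:
  fixes A :: "'n::finite tensor"
  assumes "(X \<longlongrightarrow> u) F"
  shows "((\<lambda>k. tmat m A (X k)) \<longlongrightarrow> tmat m A u) F"
  unfolding tmat_def by (intro tendsto_intros assms)

lemma tvec_scaleR: "tvec m A (c *\<^sub>R x) = c ^ (m - 1) *\<^sub>R tvec m A x"
  by (simp only: tvec_def prod_list_vec_scaleR)
    (auto simp: vec_eq_iff sum_distrib_left intro!: sum.cong)

lemma tvec_diff: "tvec m (B - A) x = tvec m B x - tvec m A x"
  by (simp add: tvec_def vec_eq_iff left_diff_distrib sum_subtractf)

lemma tvec_pencil: "tvec m (pencil A B r) x = r *\<^sub>R tvec m B x - tvec m A x"
  by (simp add: tvec_def pencil_def vec_eq_iff left_diff_distrib sum_subtractf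
      sum_distrib_left mult.assoc)

lemma tmat_pencil: "tmat m (pencil A B r) x = r *\<^sub>R tmat m B x - tmat m A x"
  by (simp add: tmat_def pencil_def vec_eq_iff left_diff_distrib sum_subtractf
      sum_distrib_left mult.assoc)

lemma tmat_mult_self:
  fixes A :: "'n::finite tensor"
  assumes "2 \<le> m"
  shows "tmat m A x *v x = tvec m A x"
proof -
  have "(\<Sum>j\<in>UNIV. (\<Sum>is | length is = m - 2. A (i # j # is) * (\<Prod>l\<leftarrow>is. x $ l)) * x $ j)
      = (\<Sum>is | length is = m - 1. A (i # is) * (\<Prod>j\<leftarrow>is. x $ j))" for i
  proof -
    have "(\<Sum>j\<in>UNIV. (\<Sum>is | length is = m - 2. A (i # j # is) * (\<Prod>l\<leftarrow>is. x $ l)) * x $ j)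
      = (\<Sum>(j, is) \<in> UNIV \<times> {is. length is = m - 2}.
          A (i # j # is) * (\<Prod>l\<leftarrow>is. x $ l) * x $ j)"
      by (simp add: sum_distrib_right sum.cartesian_product)
    also have "\<dots> = (\<Sum>is | length is = m - 1. A (i # is) * (\<Prod>j\<leftarrow>is. x $ j))"
      by (rule sum.reindex_bij_witness[where i = "\<lambda>is. (hd is, tl is)" and j = "\<lambda>(j, is). j # is"])
        (use assms in \<open>auto simp: length_greater_0_conv[symmetric] simp del: length_greater_0_conv\<close>)
    finally show ?thesis .
  qed
  then show ?thesis
    by (simp add: vec_eq_iff matrix_vector_mult_def tmat_def tvec_def)
qed

lemma tvec_mono_nonneg_tensor:
  fixes A :: "'n::finite tensor"
  assumes "2 \<le> m" and "\<forall>is. length is = m \<longrightarrow> 0 \<le> A is"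
    and "\<And>j. 0 \<le> x $ j" and "\<And>j. x $ j \<le> y $ j"
  shows "tvec m A x $ i \<le> tvec m A y $ i"
  unfolding tvec_def vec_lambda_beta
  by (intro sum_mono mult_left_mono prod_list_vec_mono) (use assms in auto)

text \<open>
  Weak irreducibility applied to the singleton \<open>{i}\<close>, a proper subset when the dimension is at
  least 2, gives a nonzero entry in every row.
\<close>

lemma tvec_pos_weakly_irreducible:
  fixes A :: "'n::finite tensor"
  assumes m: "2 \<le> m" and n: "2 \<le> CARD('n)" and A: "\<forall>is. length is = m \<longrightarrow> 0 \<le> A is"
    and irr: "weakly_irreducible m A" and x: "0 \<lless> x"
  shows "0 \<lless> tvec m A x"
  unfolding vless_def
proof
  fix i :: 'n
  have "{i} \<noteq> UNIV"
  proof
    assume "{i} = UNIV"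
    then have "CARD('n) = card {i}" by simp
    then show False using n by simp
  qed
  then obtain "is" where "is": "length is = m - 1" "A (i # is) \<noteq> 0"
    using irr[unfolded weakly_irreducible_def, rule_format, of "{i}"] by auto
  have xp: "\<And>j. 0 < x $ j" using x by (simp add: vless_def)
  have "0 < A (i # is)" using A "is" m by (simp add: order.strict_iff_order)
  then have "0 < A (i # is) * (\<Prod>j\<leftarrow>is. x $ j)"
    using prod_list_vec_pos[of x, OF xp] by simp
  also have "\<dots> \<le> tvec m A x $ i"
    unfolding tvec_def vec_lambda_beta
  proof (rule member_le_sum)
    show "0 \<le> A (i # js) * (\<Prod>j\<leftarrow>js. x $ j)" if "js \<in> {is. length is = m - 1} - {is}" for js
      using A m that prod_list_vec_pos[of x js, OF xp] by (simp add: less_imp_le)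
  qed (use "is" in auto)
  finally show "0 $ i < tvec m A x $ i" by simp
qed

section \<open>Matrices with nonpositive off-diagonal entries\<close>

definition irreducible_matrix :: "real ^ 'n ^ 'n \<Rightarrow> bool"
  where "irreducible_matrix M \<longleftrightarrow>
    (\<forall>S. S \<noteq> {} \<and> S \<noteq> UNIV \<longrightarrow> (\<exists>i\<in>S. \<exists>j. j \<notin> S \<and> M $ i $ j \<noteq> 0))"

lemma argmin_ratio:
  fixes x y :: "real ^ 'n::finite"
  assumes "0 \<lless> x"
  obtains t i where "y $ i = t * x $ i" and "\<And>j. t * x $ j \<le> y $ j"
proof -
  have xp: "\<And>j. 0 < x $ j" using assms by (simp add: vless_def)
  obtain i where i: "\<And>j. y $ i / x $ i \<le> y $ j / x $ j"
    using arg_min_if_finite(1)[of "UNIV :: 'n set" "\<lambda>j. y $ j / x $ j"]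
      arg_min_least[of "UNIV :: 'n set" _ "\<lambda>j. y $ j / x $ j"] by auto
  show thesis
  proof (rule that[of i "y $ i / x $ i"])
    show "y $ i = y $ i / x $ i * x $ i" using xp[of i] by simp
    show "y $ i / x $ i * x $ j \<le> y $ j" for j
      using i[of j] xp[of j] by (simp add: field_simps)
  qed
qed

lemma argmax_ratio:
  fixes x y :: "real ^ 'n::finite"
  assumes "0 \<lless> x"
  obtains t i where "y $ i = t * x $ i" and "\<And>j. y $ j \<le> t * x $ j"
proof -
  obtain t i where "(- y) $ i = t * x $ i" "\<And>j. t * x $ j \<le> (- y) $ j"
    by (rule argmin_ratio[OF assms, of "- y"]) blast
  then show thesis using that[of i "- t"] by (metis minus_equation_iff minus_le_iff mult_minus_left vector_uminus_component)
qed

text \<open>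
  At an index \<open>i\<close> where \<open>w\<^sub>i / x\<^sub>i\<close> attains its minimum \<open>t\<close>, the vector \<open>w - t x \<ge> 0\<close> vanishes, so the
  off-diagonal signs give \<open>(M (w - t x))\<^sub>i \<le> 0\<close>. Thus \<open>t (M x)\<^sub>i \<ge> (M w)\<^sub>i > 0\<close>, and \<open>t\<close> must be
  positive.
\<close>

lemma Z_matrix_pos_solution:
  fixes M :: "real ^ 'n::finite ^ 'n"
  assumes Z: "\<And>i j. i \<noteq> j \<Longrightarrow> M $ i $ j \<le> 0"
    and x: "0 \<lless> x" and Mx: "0 \<le> M *v x" and Mw: "0 \<lless> M *v w"
  shows "0 \<lless> w"
proof -
  obtain t i where i: "w $ i = t * x $ i" and t: "\<And>j. t * x $ j \<le> w $ j"
    by (rule argmin_ratio[OF x, of w]) blast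
  have "(M *v w) $ i - t * (M *v x) $ i = (\<Sum>j\<in>UNIV. M $ i $ j * (w $ j - t * x $ j))"
    by (simp add: matrix_vector_mult_def sum_distrib_left sum_subtractf right_diff_distrib
        mult.left_commute)
  also have "\<dots> \<le> 0"
  proof (rule sum_nonpos)
    fix j
    show "M $ i $ j * (w $ j - t * x $ j) \<le> 0"
      using Z[of i j] t[of j] i by (cases "i = j") (auto simp: mult_le_0_iff)
  qed
  finally have "0 < t * (M *v x) $ i"
    using Mw by (simp add: vless_def) (metis less_le_trans)
  moreover have "0 \<le> (M *v x) $ i" using Mx by (simp add: less_eq_vec_def)
  ultimately have "0 < t" by (simp add: zero_less_mult_iff)
  show ?thesis unfolding vless_def
  proof
    fix j
    have "0 < t * x $ j" using \<open>0 < t\<close> x by (simp add: vless_def)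
    then show "0 $ j < w $ j" using t[of j] by simp
  qed
qed

text \<open>
  With \<open>t\<close> the largest of the quotients \<open>y\<^sub>j / x\<^sub>j\<close>, the vector \<open>t x - y \<ge> 0\<close> has a nonnegative image
  under \<open>M\<close>. In a row where it vanishes this image is a sum of nonpositive terms, so each
  term is zero; irreducibility spreads the vanishing to all indices.
\<close>

lemma Z_matrix_kernel:
  fixes M :: "real ^ 'n::finite ^ 'n"
  assumes Z: "\<And>i j. i \<noteq> j \<Longrightarrow> M $ i $ j \<le> 0" and irr: "irreducible_matrix M"
    and x: "0 \<lless> x" and Mx: "0 \<le> M *v x" and y: "0 \<le> y" and My: "M *v y = 0"
  obtains t where "0 \<le> t" and "y = t *\<^sub>R x"
proof -
  obtain t i0 where i0: "y $ i0 = t * x $ i0" and t: "\<And>j. y $ j \<le> t * x $ j"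
    by (rule argmax_ratio[OF x, of y]) blast
  have "0 \<le> t * x $ i0" using y i0 by (simp add: less_eq_vec_def) metis
  then have t0: "0 \<le> t" using x by (simp add: vless_def zero_le_mult_iff) (metis not_less)
  define S where "S = {i. y $ i = t * x $ i}"
  have zero: "M $ i $ j * (t * x $ j - y $ j) = 0" if "i \<in> S" for i j
  proof -
    have le: "M $ i $ j * (t * x $ j - y $ j) \<le> 0" for j
      using Z[of i j] t[of j] that by (cases "i = j") (auto simp: mult_le_0_iff S_def)
    have "(\<Sum>j\<in>UNIV. M $ i $ j * (t * x $ j - y $ j)) = t * (M *v x) $ i - (M *v y) $ i"
      by (simp add: matrix_vector_mult_def sum_distrib_left sum_subtractf right_diff_distrib
          mult.left_commute)
    also have "\<dots> \<ge> 0"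
      using Mx My t0 by (simp add: less_eq_vec_def)
    finally have "(\<Sum>j\<in>UNIV. - (M $ i $ j * (t * x $ j - y $ j))) \<le> 0"
      by (simp add: sum_negf)
    moreover have "0 \<le> (\<Sum>j\<in>UNIV. - (M $ i $ j * (t * x $ j - y $ j)))"
      using le by (intro sum_nonneg) simp
    ultimately have "(\<Sum>j\<in>UNIV. - (M $ i $ j * (t * x $ j - y $ j))) = 0" by linarith
    then show ?thesis
      using le by (subst (asm) sum_nonneg_eq_0_iff) auto
  qed
  have "S = UNIV"
  proof (rule ccontr)
    assume "S \<noteq> UNIV"
    moreover have "S \<noteq> {}" using i0 by (auto simp: S_def)
    ultimately obtain i j where "i \<in> S" "j \<notin> S" "M $ i $ j \<noteq> 0"
      using irr unfolding irreducible_matrix_def by blast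
    then show False using zero[of i j] by (simp add: S_def)
  qed
  then have "y = t *\<^sub>R x" by (auto simp: vec_eq_iff S_def)
  then show thesis using that t0 by blast
qed

section \<open>Tensors with nonpositive off-diagonal entries\<close>

definition Z_tensor :: "nat \<Rightarrow> 'n tensor \<Rightarrow> bool"
  where "Z_tensor m P \<longleftrightarrow>
    (\<forall>i is. length is = m - 1 \<and> is \<noteq> replicate (m - 1) i \<longrightarrow> P (i # is) \<le> 0)"

lemma Z_tensor_term_antimono:
  fixes x y :: "real ^ 'n"
  assumes Z: "Z_tensor m P" and x: "\<And>j. 0 \<le> x $ j" and xy: "\<And>j. x $ j \<le> y $ j"
    and eq: "x $ i = y $ i" and len: "length is = m - 1"
  shows "P (i # is) * (\<Prod>j\<leftarrow>is. y $ j) \<le> P (i # is) * (\<Prod>j\<leftarrow>is. x $ j)"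
proof (cases "is = replicate (m - 1) i")
  case True
  then show ?thesis using eq by simp
next
  case False
  then have "P (i # is) \<le> 0" using Z len by (simp add: Z_tensor_def)
  then show ?thesis using prod_list_vec_mono[of x y, OF x xy] by (intro mult_left_mono_neg)
qed

lemma Z_tensor_comparison:
  fixes P :: "'n::finite tensor"
  assumes "Z_tensor m P" and "\<And>j. 0 \<le> x $ j" and "\<And>j. x $ j \<le> y $ j"
    and "x $ i = y $ i"
  shows "tvec m P y $ i \<le> tvec m P x $ i"
  unfolding tvec_def vec_lambda_beta
  using Z_tensor_term_antimono[of m P x y i] assms by (intro sum_mono) auto

lemma Z_tensor_linking_entry_neg:
  assumes "Z_tensor m P" and "length is = m - 1" and "j \<in> set is" and "j \<noteq> i" and "P (i # is) \<noteq> 0"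
  shows "P (i # is) < 0"
proof -
  have "is \<noteq> replicate (m - 1) i" using assms(3,4) by auto
  then show ?thesis using assms by (force simp: Z_tensor_def order.strict_iff_order)
qed

text \<open>
  The analogue of \<open>Z_matrix_kernel\<close> for tensors, a strong maximum principle. If the set \<open>S\<close> of
  indices with \<open>v\<^sub>i = t x\<^sub>i\<close>, where \<open>t\<close> is the largest quotient, were proper, an entry leading out of
  \<open>S\<close> would make \<open>P (t x)\<^sup>m\<^sup>-\<^sup>1\<close> smaller than \<open>P v\<^sup>m\<^sup>-\<^sup>1\<close> at some \<open>i \<in> S\<close>, hence negative there. That
  the monomial grows strictly uses that all entries of \<open>v\<close> are positive.
\<close>

lemma Z_tensor_rigidity:
  fixes P :: "'n::finite tensor"
  assumes Z: "Z_tensor m P" and irr: "weakly_irreducible m P"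
    and x: "0 \<lless> x" and v: "0 \<lless> v" and Px: "0 \<le> tvec m P x" and Pv: "tvec m P v \<le> 0"
  obtains t where "0 < t" and "v = t *\<^sub>R x"
proof -
  have xp: "\<And>j. 0 < x $ j" and vp: "\<And>j. 0 < v $ j" using x v by (simp_all add: vless_def)
  obtain t i0 where i0: "v $ i0 = t * x $ i0" and t: "\<And>j. v $ j \<le> t * x $ j"
    by (rule argmax_ratio[OF x, of v]) blast
  have "0 < t" using vp[of i0] xp[of i0] i0 by (simp add: zero_less_mult_iff)
  define S where "S = {i. v $ i = t * x $ i}"
  have "S = UNIV"
  proof (rule ccontr)
    assume "S \<noteq> UNIV"
    moreover have "S \<noteq> {}" using i0 by (auto simp: S_def)
    ultimately obtain i "is" j where i: "i \<in> S" and len: "length is = m - 1"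
      and j: "j \<in> set is" "j \<notin> S" and P: "P (i # is) \<noteq> 0"
      using irr unfolding weakly_irreducible_def by blast
    have neg: "P (i # is) < 0"
      using Z_tensor_linking_entry_neg[OF Z len j(1) _ P] i j(2) by blast
    have "v $ j < (t *\<^sub>R x) $ j" using t[of j] j(2) by (simp add: S_def)
    then have less: "(\<Prod>j\<leftarrow>is. v $ j) < (\<Prod>j\<leftarrow>is. (t *\<^sub>R x) $ j)"
      using prod_list_vec_strict_mono[of v "t *\<^sub>R x" j "is"] vp t j(1) by simp
    have "tvec m P (t *\<^sub>R x) $ i < tvec m P v $ i"
      unfolding tvec_def vec_lambda_beta
    proof (rule sum_strict_mono_ex1)
      show "\<forall>is\<in>{is. length is = m - 1}. P (i # is) * (\<Prod>j\<leftarrow>is. (t *\<^sub>R x) $ j)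
          \<le> P (i # is) * (\<Prod>j\<leftarrow>is. v $ j)"
        using Z_tensor_term_antimono[OF Z, of v "t *\<^sub>R x" i] i vp t
        by (auto simp: S_def less_imp_le)
      show "\<exists>is\<in>{is. length is = m - 1}. P (i # is) * (\<Prod>j\<leftarrow>is. (t *\<^sub>R x) $ j)
          < P (i # is) * (\<Prod>j\<leftarrow>is. v $ j)"
        using len neg less by (intro bexI[of _ "is"]) auto
    qed simp
    also have "\<dots> \<le> 0" using Pv by (simp add: less_eq_vec_def)
    finally have "t ^ (m - 1) * tvec m P x $ i < 0" by (simp add: tvec_scaleR)
    moreover have "0 \<le> t ^ (m - 1) * tvec m P x $ i"
      using \<open>0 < t\<close> Px by (simp add: less_eq_vec_def)
    ultimately show False by simp
  qed
  then have "v = t *\<^sub>R x" by (auto simp: vec_eq_iff S_def)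
  then show thesis using that \<open>0 < t\<close> by blast
qed

lemma Z_tensor_tmat_nonpos:
  fixes P :: "'n::finite tensor"
  assumes "2 \<le> m" and Z: "Z_tensor m P" and x: "0 \<lless> x" and "i \<noteq> j"
  shows "tmat m P x $ i $ j \<le> 0"
  unfolding tmat_def vec_lambda_beta
proof (rule sum_nonpos)
  fix "is" :: "'n list"
  assume "is \<in> {is. length is = m - 2}"
  moreover have "j # is \<noteq> replicate (m - 1) i" using \<open>i \<noteq> j\<close> by (cases "m - 1") auto
  ultimately have "P (i # j # is) \<le> 0"
    using Z \<open>2 \<le> m\<close> by (force simp: Z_tensor_def)
  then show "P (i # j # is) * (\<Prod>l\<leftarrow>is. x $ l) \<le> 0"
    using prod_list_vec_pos[of x "is"] x by (simp add: vless_def mult_le_0_iff)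
qed

text \<open>
  Weak irreducibility links \<open>i \<in> S\<close> to an index \<open>j \<notin> S\<close> at any position of an entry, whereas the matrix
  only shows the second one. Semisymmetry moves \<open>j\<close> to that position.
\<close>

lemma Z_tensor_tmat_irreducible:
  fixes P :: "'n::finite tensor"
  assumes m: "2 \<le> m" and Z: "Z_tensor m P" and irr: "weakly_irreducible m P"
    and sym: "semisymmetric m P" and x: "0 \<lless> x"
  shows "irreducible_matrix (tmat m P x)"
  unfolding irreducible_matrix_def
proof (intro allI impI, elim conjE)
  fix S :: "'n set"
  assume "S \<noteq> {}" "S \<noteq> UNIV"
  then obtain i "is" j where i: "i \<in> S" and len: "length is = m - 1"
    and j: "j \<in> set is" "j \<notin> S" and P: "P (i # is) \<noteq> 0"
    using irr unfolding weakly_irreducible_def by blast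
  have ij: "i \<noteq> j" using i j by blast
  have neg: "P (i # is) < 0"
    using Z_tensor_linking_entry_neg[OF Z len j(1) _ P] ij by blast
  define js where "js = remove1 j is"
  have len_js: "length js = m - 2" using len j by (simp add: js_def length_remove1)
  have "P (i # is) = P (i # j # js)"
    using sym[unfolded semisymmetric_def, rule_format, of "is" "j # js" i] len j by (simp add: js_def)
  then have neg': "P (i # j # js) < 0" using neg by simp
  have xp: "\<And>j. 0 < x $ j" using x by (simp add: vless_def)
  have nonpos: "P (i # j # is) * (\<Prod>l\<leftarrow>is. x $ l) \<le> 0" if "length is = m - 2" for "is"
  proof -
    have "j # is \<noteq> replicate (m - 1) i" using ij by (cases "m - 1") auto
    then have "P (i # j # is) \<le> 0" using Z m that by (force simp: Z_tensor_def)
    then show ?thesis using prod_list_vec_pos[of x "is", OF xp] by (simp add: mult_le_0_iff)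
  qed
  have "tmat m P x $ i $ j < (\<Sum>is \<in> {is :: 'n list. length is = m - 2}. 0)"
    unfolding tmat_def vec_lambda_beta
    by (rule sum_strict_mono_ex1)
      (use nonpos neg' len_js prod_list_vec_pos[of x js, OF xp] in \<open>auto simp: mult_less_0_iff\<close>)
  then have "tmat m P x $ i $ j \<noteq> 0" by simp
  then show "\<exists>i\<in>S. \<exists>j. j \<notin> S \<and> tmat m P x $ i $ j \<noteq> 0" using i j by blast
qed

section \<open>A Harnack inequality\<close>

lemma prod_list_vec_lower_bound:
  fixes x :: "real ^ 'n"
  assumes s: "0 \<le> s" "\<And>j. s \<le> x $ j" and l: "l \<in> set is"
  shows "s ^ (length is - 1) * x $ l \<le> (\<Prod>j\<leftarrow>is. x $ j)"
proof -
  have x: "0 \<le> x $ j" for j using s(1) s(2)[of j] by linarith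
  have pow: "s ^ length is \<le> (\<Prod>j\<leftarrow>is. x $ j)" for "is"
    by (induction "is") (auto intro!: mult_mono s x prod_list_vec_nonneg zero_le_power)
  obtain us vs where "is": "is = us @ l # vs" using l by (auto simp: in_set_conv_decomp)
  have "s ^ (length is - 1) * x $ l = s ^ length (us @ vs) * x $ l" by (simp add: "is")
  also have "\<dots> \<le> (\<Prod>j\<leftarrow>us @ vs. x $ j) * x $ l"
    by (intro mult_right_mono pow x)
  finally show ?thesis by (simp add: "is" mult.commute mult.left_commute)
qed

text \<open>
  The hypothesis on \<open>x\<close> bounds every off-diagonal term of row \<open>i\<close> by the diagonal monomial. Call an
  entry of \<open>x\<close> low if it is at most \<open>K\<close> times the smallest entry \<open>s\<close>. If not all entries are
  low, some nonzero tensor entry leads from a low index \<open>i\<close> to an index \<open>l\<close> that is not low; its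
  monomial is at least \<open>s\<^sup>m\<^sup>-\<^sup>2 x\<^sub>l\<close>, while \<open>x\<^sub>i\<^sup>m\<^sup>-\<^sup>1 \<le> (K s)\<^sup>m\<^sup>-\<^sup>1\<close>. So \<open>x\<^sub>l\<close> is low for a larger
  constant, which does not depend on \<open>x\<close>, and after at most \<open>CARD('n)\<close> enlargements all are.
\<close>

lemma weakly_irreducible_harnack:
  fixes A :: "'n::finite tensor"
  assumes m: "2 \<le> m" and A: "\<forall>is. length is = m \<longrightarrow> 0 \<le> A is"
    and irr: "weakly_irreducible m A"
  obtains K where "0 < K" and "\<And>x i j. \<lbrakk>0 \<lless> x;
      \<And>i is. length is = m - 1 \<Longrightarrow> is \<noteq> replicate (m - 1) i \<Longrightarrow>
        A (i # is) * (\<Prod>j\<leftarrow>is. x $ j) \<le> \<beta> * x $ i ^ (m - 1)\<rbrakk> \<Longrightarrow> x $ i \<le> K * x $ j"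
proof -
  \<comment> \<open>The constant needs a positive lower bound for the nonzero entries; \<open>1\<close> is inserted in case
    there are none.\<close>
  define E where "E = {A is |is. length is = m \<and> A is \<noteq> 0}"
  have "finite ((\<lambda>is. A is) ` {is. length is = m})" by simp
  then have "finite E" by (rule finite_subset[rotated]) (auto simp: E_def)
  define a where "a = Min (insert 1 E)"
  have a: "0 < a" using \<open>finite E\<close> A unfolding a_def
    by (subst Min_gr_iff) (auto simp: E_def order.strict_iff_order)
  have aE: "a \<le> A is" if "length is = m" "A is \<noteq> 0" for "is"
    unfolding a_def by (rule Min_le) (use \<open>finite E\<close> that in \<open>auto simp: E_def\<close>)
  define adm where "adm x \<longleftrightarrow> 0 \<lless> x \<and> (\<forall>i is. length is = m - 1 \<and> is \<noteq> replicate (m - 1) i \<longrightarrow>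
        A (i # is) * (\<Prod>j\<leftarrow>is. x $ j) \<le> \<beta> * x $ i ^ (m - 1))" for x
  \<comment> \<open>Comparing with all entries is comparing with the smallest one.\<close>
  define L where "L K x = {i. \<forall>j. x $ i \<le> K * x $ j}" for K and x :: "real ^ 'n"
  have "\<exists>K\<ge>1. \<forall>x. adm x \<longrightarrow> L K x = UNIV \<or> r \<le> card (L K x)" for r
  proof (induction r)
    case 0
    show ?case by (intro exI[of _ 1]) auto
  next
    case (Suc r)
    then obtain K where K: "1 \<le> K" "\<And>x. adm x \<Longrightarrow> L K x = UNIV \<or> r \<le> card (L K x)" by blast
    define K' where "K' = max K (\<bar>\<beta>\<bar> * K ^ (m - 1) / a)"
    have "L K' x = UNIV \<or> Suc r \<le> card (L K' x)" if x: "adm x" for x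
    proof -
      have xp: "\<And>j. 0 < x $ j" using x by (simp add: adm_def vless_def)
      have sub: "L K x \<subseteq> L K' x"
      proof
        fix i assume "i \<in> L K x"
        then have "x $ i \<le> K * x $ j" for j by (simp add: L_def)
        moreover have "K * x $ j \<le> K' * x $ j" for j
          using xp[of j] by (simp add: K'_def)
        ultimately show "i \<in> L K' x" unfolding L_def using order_trans by blast
      qed
      show ?thesis
      proof (cases "L K x = UNIV")
        case True
        then show ?thesis using sub by auto
      next
        case False
        obtain i0 where i0: "\<And>j. x $ i0 \<le> x $ j"
          using arg_min_least[of "UNIV :: 'n set" _ "\<lambda>j. x $ j"] by auto
        have "x $ i0 \<le> K * x $ j" for j
          using mult_mono[of 1 K "x $ i0" "x $ j"] i0[of j] K(1) xp[of i0] by simp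
        then have "L K x \<noteq> {}" by (auto simp: L_def)
        with False obtain i "is" l where i: "i \<in> L K x" and len: "length is = m - 1"
          and l: "l \<in> set is" "l \<notin> L K x" and ne: "A (i # is) \<noteq> 0"
          using irr unfolding weakly_irreducible_def by blast
        define s where "s = x $ i0"
        have s: "0 < s" "\<And>j. s \<le> x $ j" using xp i0 by (simp_all add: s_def)
        have "is \<noteq> replicate (m - 1) i" using l i by auto
        have "a * (s ^ (m - 2) * x $ l) \<le> A (i # is) * (\<Prod>j\<leftarrow>is. x $ j)"
        proof (rule mult_mono)
          show "a \<le> A (i # is)" using aE ne len m by simp
          show "s ^ (m - 2) * x $ l \<le> (\<Prod>j\<leftarrow>is. x $ j)"
            using prod_list_vec_lower_bound[of s x l "is"] s l len
            by (simp add: less_imp_le numeral_2_eq_2)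
          show "0 \<le> A (i # is)" using A len m by simp
          show "0 \<le> s ^ (m - 2) * x $ l" using s xp[of l] by simp
        qed
        also have "\<dots> \<le> \<beta> * x $ i ^ (m - 1)"
          using x len \<open>is \<noteq> _\<close> by (auto simp: adm_def)
        also have "\<dots> \<le> \<bar>\<beta>\<bar> * x $ i ^ (m - 1)"
          using xp[of i] by (intro mult_right_mono) auto
        also have "\<dots> \<le> \<bar>\<beta>\<bar> * (K * s) ^ (m - 1)"
          using xp[of i] i by (intro mult_left_mono power_mono) (auto simp: L_def s_def)
        also have "\<dots> = \<bar>\<beta>\<bar> * K ^ (m - 1) * (s ^ (m - 2) * s)"
          using m by (simp add: power_mult_distrib Suc_diff_Suc numeral_2_eq_2 flip: power_Suc2)
        finally have "s ^ (m - 2) * (a * x $ l) \<le> s ^ (m - 2) * (\<bar>\<beta>\<bar> * K ^ (m - 1) * s)"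
          by (simp add: mult_ac)
        then have "a * x $ l \<le> \<bar>\<beta>\<bar> * K ^ (m - 1) * s"
          using s(1) by (subst (asm) mult_le_cancel_left_pos) auto
        then have "x $ l \<le> \<bar>\<beta>\<bar> * K ^ (m - 1) / a * s"
          using a by (simp add: field_simps)
        also have "\<dots> \<le> K' * s"
          unfolding K'_def using s(1) by (intro mult_right_mono) auto
        finally have xl: "x $ l \<le> K' * s" .
        have "0 \<le> K'" using K(1) by (simp add: K'_def)
        have "l \<in> L K' x" unfolding L_def
          using xl mult_left_mono[OF s(2) \<open>0 \<le> K'\<close>] order_trans by blast
        then have "insert l (L K x) \<subseteq> L K' x" using sub by simp
        then have "card (insert l (L K x)) \<le> card (L K' x)" by (intro card_mono) auto
        then show ?thesis using l(2) K(2)[OF x] False by simp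
      qed
    qed
    moreover have "1 \<le> K'" using K(1) by (simp add: K'_def)
    ultimately show ?case by blast
  qed
  from this[of "CARD('n)"] obtain K where K: "1 \<le> K"
    "\<And>x. adm x \<Longrightarrow> L K x = UNIV \<or> CARD('n) \<le> card (L K x)" by blast
  have L: "L K x = UNIV" if "adm x" for x
    using K(2)[OF that] card_seteq[of "UNIV :: 'n set" "L K x"] by auto
  show thesis
  proof (rule that[of K])
    show "0 < K" using K(1) by simp
    show "x $ i \<le> K * x $ j" if "0 \<lless> x" "\<And>i is. length is = m - 1 \<Longrightarrow> is \<noteq> replicate (m - 1) i \<Longrightarrow>
        A (i # is) * (\<Prod>j\<leftarrow>is. x $ j) \<le> \<beta> * x $ i ^ (m - 1)" for x i j
      using L[of x] that by (auto simp: adm_def L_def)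
  qed
qed

section \<open>The pencil of a generalized M-tensor pair\<close>

lemma semisymmetric_pencil:
  assumes "semisymmetric m A" and "semisymmetric m B"
  shows "semisymmetric m (pencil A B r)"
  using assms unfolding semisymmetric_def pencil_def by metis

lemma pencil_off_diagonal_le:
  assumes m: "2 \<le> m" and pair: "generalized_M_tensor_pair m A B" and r: "0 \<le> r"
    and "is": "length is = m - 1" "is \<noteq> replicate (m - 1) i"
  shows "pencil A B r (i # is) \<le> - ((1 - r) * A (i # is))"
proof -
  have "B (i # is) \<le> A (i # is)" using pair "is" by (simp add: generalized_M_tensor_pair_def)
  then have "r * B (i # is) \<le> r * A (i # is)" using r by (rule mult_left_mono)
  then show ?thesis by (simp add: pencil_def algebra_simps)
qed

lemma pencil_Z_tensor:
  fixes A :: "'n::finite tensor"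
  assumes m: "2 \<le> m" and pair: "generalized_M_tensor_pair m A B" and r: "0 \<le> r" "r \<le> 1"
  shows "Z_tensor m (pencil A B r)"
  unfolding Z_tensor_def
proof (intro allI impI, elim conjE)
  fix i and "is" :: "'n list" assume "is": "length is = m - 1" "is \<noteq> replicate (m - 1) i"
  have "0 \<le> A (i # is)" using pair "is" m by (simp add: generalized_M_tensor_pair_def)
  then have "0 \<le> (1 - r) * A (i # is)" using r by simp
  then show "pencil A B r (i # is) \<le> 0"
    using pencil_off_diagonal_le[OF m pair r(1) "is"] by linarith
qed

lemma pencil_weakly_irreducible:
  fixes A :: "'n::finite tensor"
  assumes m: "2 \<le> m" and pair: "generalized_M_tensor_pair m A B" and r: "0 \<le> r" "r < 1"
  shows "weakly_irreducible m (pencil A B r)"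
  unfolding weakly_irreducible_def
proof (intro allI impI, elim conjE)
  fix S :: "'n set" assume "S \<noteq> {}" "S \<noteq> UNIV"
  then obtain i "is" j where i: "i \<in> S" and len: "length is = m - 1"
    and j: "j \<in> set is" "j \<notin> S" and ne: "A (i # is) \<noteq> 0"
    using pair unfolding generalized_M_tensor_pair_def weakly_irreducible_def by blast
  have "0 \<le> A (i # is)" using pair len m by (simp add: generalized_M_tensor_pair_def)
  then have "0 < (1 - r) * A (i # is)" using ne r by simp
  moreover have "is \<noteq> replicate (m - 1) i" using i j by auto
  ultimately have "pencil A B r (i # is) < 0"
    using pencil_off_diagonal_le[OF m pair r(1) len] by fastforce
  then show "\<exists>i\<in>S. \<exists>is. length is = m - 1 \<and> (\<exists>j\<in>set is. j \<notin> S) \<and> pencil A B r (i # is) \<noteq> 0"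
    using i len j by (metis less_irrefl)
qed

text \<open>
  If a row of \<open>P x\<^sup>m\<^sup>-\<^sup>1\<close> is nonnegative, its diagonal term outweighs each of the nonpositive
  off-diagonal terms. As those carry at least a fraction \<open>1 - r \<ge> 1 - r0\<close> of the terms of \<open>A\<close>, the
  hypothesis of \<open>weakly_irreducible_harnack\<close> holds with a constant independent of \<open>r\<close>.
\<close>

lemma pencil_harnack:
  fixes A B :: "'n::finite tensor"
  assumes m: "2 \<le> m" and pair: "generalized_M_tensor_pair m A B" and r0: "r0 < 1"
  obtains K where "0 < K" and "\<And>r x i j. \<lbrakk>0 \<le> r; r \<le> r0; 0 \<lless> x;
    0 \<le> tvec m (pencil A B r) x\<rbrakk> \<Longrightarrow> x $ i \<le> K * x $ j"
proof -
  have A: "\<forall>is. length is = m \<longrightarrow> 0 \<le> A is" and irr: "weakly_irreducible m A"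
    using pair by (simp_all add: generalized_M_tensor_pair_def)
  define D where "D = (\<Sum>i\<in>UNIV. \<bar>B (i # replicate (m - 1) i)\<bar>)"
  obtain K where K: "0 < K" and har: "\<And>x i j. \<lbrakk>0 \<lless> x;
      \<And>i is. length is = m - 1 \<Longrightarrow> is \<noteq> replicate (m - 1) i \<Longrightarrow>
        A (i # is) * (\<Prod>j\<leftarrow>is. x $ j) \<le> D / (1 - r0) * x $ i ^ (m - 1)\<rbrakk> \<Longrightarrow> x $ i \<le> K * x $ j"
    by (rule weakly_irreducible_harnack[OF m A irr, of "D / (1 - r0)"]) blast
  show thesis
  proof (rule that[OF K])
    fix r x i j
    assume r: "0 \<le> r" "r \<le> r0" and x: "0 \<lless> x" and Px: "0 \<le> tvec m (pencil A B r) x"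
    have xp: "\<And>j. 0 < x $ j" using x by (simp add: vless_def)
    show "x $ i \<le> K * x $ j"
    proof (rule har[OF x])
      fix i and "is" :: "'n list" assume "is": "length is = m - 1" "is \<noteq> replicate (m - 1) i"
      let ?d = "replicate (m - 1) i"
      let ?p = "\<lambda>is. \<Prod>j\<leftarrow>is. x $ j"
      let ?f = "\<lambda>is. pencil A B r (i # is) * ?p is"
      let ?I = "{is. length is = m - 1}"
      have A_is: "0 \<le> A (i # is) * ?p is"
        using A "is" m prod_list_vec_pos[of x "is", OF xp] by (simp add: less_imp_le)
      have "Z_tensor m (pencil A B r)" using pencil_Z_tensor[OF m pair r(1)] r r0 by simp
      then have nonpos: "?f js \<le> 0" if "js \<in> ?I - {?d} - {is}" for js
        using that prod_list_vec_pos[of x js, OF xp] by (auto simp: Z_tensor_def mult_le_0_iff)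
      have "0 \<le> sum ?f ?I" using Px by (simp add: less_eq_vec_def tvec_def)
      also have "sum ?f ?I = ?f ?d + (?f is + sum ?f (?I - {?d} - {is}))"
        using sum.remove[of ?I ?d ?f] sum.remove[of "?I - {?d}" "is" ?f] "is" by simp
      also have "\<dots> \<le> ?f ?d + ?f is"
        using sum_nonpos[of "?I - {?d} - {is}" ?f] nonpos by auto
      finally have "- ?f is \<le> ?f ?d" by linarith
      have "(1 - r0) * (A (i # is) * ?p is) \<le> (1 - r) * (A (i # is) * ?p is)"
        using r A_is by (intro mult_right_mono) auto
      also have "\<dots> \<le> - ?f is"
        using mult_right_mono[OF pencil_off_diagonal_le[OF m pair r(1) "is"], of "?p is"]
          prod_list_vec_pos[of x "is", OF xp] by (simp add: mult.assoc)
      also have "\<dots> \<le> ?f ?d" by fact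
      also have "\<dots> \<le> D * x $ i ^ (m - 1)"
      proof -
        have "r * B (i # ?d) \<le> \<bar>B (i # ?d)\<bar>"
        proof -
          have "r * B (i # ?d) \<le> r * \<bar>B (i # ?d)\<bar>" using r by (intro mult_left_mono) auto
          also have "\<dots> \<le> 1 * \<bar>B (i # ?d)\<bar>" using r r0 by (intro mult_right_mono) auto
          finally show ?thesis by simp
        qed
        moreover have "0 \<le> A (i # ?d)" using A m by simp
        moreover have "\<bar>B (i # ?d)\<bar> \<le> D" unfolding D_def by (rule member_le_sum) auto
        ultimately have "pencil A B r (i # ?d) \<le> D" by (simp add: pencil_def)
        then show ?thesis using xp[of i] by (simp add: mult_right_mono)
      qed
      finally show "A (i # is) * ?p is \<le> D / (1 - r0) * x $ i ^ (m - 1)"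
        using r0 by (simp add: field_simps)
    qed
  qed
qed

section \<open>Uniqueness of the positive eigenpair\<close>

text \<open>
  The vector \<open>u\<close> with \<open>(B - A) u\<^sup>m\<^sup>-\<^sup>1 > 0\<close> serves as a barrier: where \<open>v\<^sub>i / u\<^sub>i\<close> is largest, comparison
  makes \<open>(B - A) v\<^sup>m\<^sup>-\<^sup>1\<close> positive as well, which for an eigenvector means \<open>\<mu> < 1\<close>.
\<close>

lemma positive_eigenvalue_less_1:
  fixes A B :: "'n::finite tensor"
  assumes m: "2 \<le> m" and pair: "generalized_M_tensor_pair m A B" and n: "2 \<le> CARD('n)"
    and v: "0 \<lless> v" and eig: "tvec m A v = \<mu> *\<^sub>R tvec m B v" and \<mu>: "0 < \<mu>"
  shows "\<mu> < 1" and "0 \<lless> tvec m B v"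
proof -
  have "0 \<lless> tvec m A v"
    using tvec_pos_weakly_irreducible[OF m n _ _ v] pair by (simp add: generalized_M_tensor_pair_def)
  then show Bv: "0 \<lless> tvec m B v" using eig \<mu> by (simp add: vless_def zero_less_mult_iff)
  obtain u where u: "0 \<lless> u" "tvec m A u \<lless> tvec m B u"
    using pair by (auto simp: generalized_M_tensor_pair_def)
  obtain t i where i: "v $ i = t * u $ i" and t: "\<And>j. v $ j \<le> t * u $ j"
    by (rule argmax_ratio[OF u(1), of v]) blast
  have "0 < t" using i u(1) v by (metis vless_def zero_index zero_less_mult_pos2)
  have Z: "Z_tensor m (pencil A B 1)" by (rule pencil_Z_tensor[OF m pair]) auto
  have "0 < t ^ (m - 1) * tvec m (pencil A B 1) u $ i"
    using \<open>0 < t\<close> u(2) by (simp add: tvec_pencil vless_def)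
  also have "\<dots> = tvec m (pencil A B 1) (t *\<^sub>R u) $ i" by (simp add: tvec_scaleR)
  also have "\<dots> \<le> tvec m (pencil A B 1) v $ i"
    by (rule Z_tensor_comparison[OF Z]) (use v i t in \<open>auto simp: vless_def less_imp_le\<close>)
  finally have "\<mu> * tvec m B v $ i < 1 * tvec m B v $ i" by (simp add: tvec_pencil eig)
  then show "\<mu> < 1" using Bv by (subst (asm) mult_less_cancel_right_pos) (simp_all add: vless_def)
qed

text \<open>
  For \<open>P = \<mu> B - A\<close> one has \<open>P v\<^sup>m\<^sup>-\<^sup>1 = 0\<close> and \<open>P u\<^sup>m\<^sup>-\<^sup>1 = (\<mu> - lam) B u\<^sup>m\<^sup>-\<^sup>1 \<ge> 0\<close>. By
  \<open>Z_tensor_rigidity\<close>, \<open>v\<close> is a multiple of \<open>u\<close>, and then the second expression is zero too.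
\<close>

lemma positive_eigenpair_unique_ordered:
  fixes A B :: "'n::finite tensor"
  assumes m: "2 \<le> m" and pair: "generalized_M_tensor_pair m A B" and n: "2 \<le> CARD('n)"
    and u: "0 \<lless> u" "tvec m A u = lam *\<^sub>R tvec m B u" and lam: "0 < lam" "lam \<le> \<mu>"
    and v: "0 \<lless> v" "tvec m A v = \<mu> *\<^sub>R tvec m B v"
  shows "\<mu> = lam" and "norm u = 1 \<Longrightarrow> norm v = 1 \<Longrightarrow> v = u"
proof -
  have \<mu>: "0 < \<mu>" "\<mu> < 1" using positive_eigenvalue_less_1[OF m pair n v] lam by simp_all
  have Bu: "0 \<lless> tvec m B u" by (rule positive_eigenvalue_less_1[OF m pair n u lam(1)])
  have Z: "Z_tensor m (pencil A B \<mu>)" by (rule pencil_Z_tensor[OF m pair]) (use \<mu> in auto)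
  have irr: "weakly_irreducible m (pencil A B \<mu>)"
    by (rule pencil_weakly_irreducible[OF m pair]) (use \<mu> in auto)
  have Pu: "tvec m (pencil A B \<mu>) u = (\<mu> - lam) *\<^sub>R tvec m B u"
    by (simp add: tvec_pencil u algebra_simps)
  have Pv: "tvec m (pencil A B \<mu>) v = 0" by (simp add: tvec_pencil v)
  obtain t where t: "0 < t" "v = t *\<^sub>R u"
  proof (rule Z_tensor_rigidity[OF Z irr u(1) v(1)])
    show "0 \<le> tvec m (pencil A B \<mu>) u"
      using Bu lam by (simp add: Pu less_eq_vec_def vless_def less_imp_le)
  qed (simp_all add: Pv)
  have "t ^ (m - 1) *\<^sub>R ((\<mu> - lam) *\<^sub>R tvec m B u) = 0"
    using Pv by (simp add: t tvec_scaleR flip: Pu)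
  moreover have "tvec m B u \<noteq> 0" using Bu by (auto simp: vless_def)
  ultimately show "\<mu> = lam" using t by simp
  show "v = u" if "norm u = 1" "norm v = 1" using that t by simp
qed

lemma positive_eigenpair_unique:
  fixes A B :: "'n::finite tensor"
  assumes m: "2 \<le> m" and pair: "generalized_M_tensor_pair m A B" and n: "2 \<le> CARD('n)"
    and u: "0 \<lless> u" "tvec m A u = lam *\<^sub>R tvec m B u" "0 < lam"
    and v: "0 \<lless> v" "tvec m A v = \<mu> *\<^sub>R tvec m B v" "0 < \<mu>"
  shows "\<mu> = lam" and "norm u = 1 \<Longrightarrow> norm v = 1 \<Longrightarrow> v = u"
proof -
  consider "lam \<le> \<mu>" | "\<mu> \<le> lam" by linarith
  then have "\<mu> = lam \<and> (norm u = 1 \<longrightarrow> norm v = 1 \<longrightarrow> v = u)"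
  proof cases
    case 1
    then show ?thesis using positive_eigenpair_unique_ordered[OF m pair n u 1 v(1,2)] by blast
  next
    case 2
    then show ?thesis using positive_eigenpair_unique_ordered[OF m pair n v 2 u(1,2)] by blast
  qed
  then show "\<mu> = lam" "norm u = 1 \<Longrightarrow> norm v = 1 \<Longrightarrow> v = u" by auto
qed

section \<open>Invariants of the iteration\<close>

lemma max_ratio_properties:
  fixes A B :: "'n::finite tensor"
  assumes B: "0 \<lless> tvec m B x"
  shows "0 \<le> tvec m (pencil A B (max_ratio m A B x)) x"
    and "\<exists>i. tvec m A x $ i = max_ratio m A B x * tvec m B x $ i"
proof -
  have Bp: "\<And>i. 0 < tvec m B x $ i" using B by (simp add: vless_def)
  have "tvec m A x $ i / tvec m B x $ i \<le> max_ratio m A B x" for i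
    unfolding max_ratio_def by (rule Max_ge) auto
  then show "0 \<le> tvec m (pencil A B (max_ratio m A B x)) x"
    using Bp by (simp add: tvec_pencil less_eq_vec_def field_simps)
  have "max_ratio m A B x \<in> range (\<lambda>i. tvec m A x $ i / tvec m B x $ i)"
    unfolding max_ratio_def by (rule Max_in) auto
  then obtain i where "max_ratio m A B x = tvec m A x $ i / tvec m B x $ i" by blast
  then show "\<exists>i. tvec m A x $ i = max_ratio m A B x * tvec m B x $ i"
    using Bp[of i] by (intro exI[of _ i]) simp
qed

lemma max_ratio_between_0_1:
  fixes A B :: "'n::finite tensor" and x :: "real ^ 'n"
  assumes m: "2 \<le> m" and n: "2 \<le> CARD('n)" and pair: "generalized_M_tensor_pair m A B"
    and x: "0 \<lless> x" and C: "0 \<lless> tvec m (B - A) x"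
  shows "0 \<lless> tvec m A x" and "0 \<lless> tvec m B x"
    and "0 < max_ratio m A B x" and "max_ratio m A B x < 1"
proof -
  show A: "0 \<lless> tvec m A x"
    using tvec_pos_weakly_irreducible[OF m n _ _ x] pair by (simp add: generalized_M_tensor_pair_def)
  have AB: "tvec m A x $ i < tvec m B x $ i" for i
    using C by (simp add: tvec_diff vless_def)
  show B: "0 \<lless> tvec m B x" using A AB by (auto simp: vless_def intro: less_trans)
  obtain i where i: "tvec m A x $ i = max_ratio m A B x * tvec m B x $ i"
    using max_ratio_properties(2)[OF B] by blast
  have Ai: "0 < tvec m A x $ i" and Bi: "0 < tvec m B x $ i" using A B by (simp_all add: vless_def)
  show "0 < max_ratio m A B x" using Ai Bi i by (simp add: zero_less_mult_iff)
  have "max_ratio m A B x * tvec m B x $ i < 1 * tvec m B x $ i" using AB[of i] i by simp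
  then show "max_ratio m A B x < 1" using Bi by (subst (asm) mult_less_cancel_right_pos)
qed

lemma newton_direction_pos:
  fixes A B :: "'n::finite tensor" and x w :: "real ^ 'n"
  assumes m: "2 \<le> m" and n: "2 \<le> CARD('n)" and pair: "generalized_M_tensor_pair m A B"
    and x: "0 \<lless> x" and C: "0 \<lless> tvec m (B - A) x"
    and w: "(real (m - 1) *\<^sub>R tmat m (pencil A B (max_ratio m A B x)) x) *v w = tvec m B x"
  shows "0 \<lless> w"
proof (rule Z_matrix_pos_solution[OF _ x])
  let ?P = "pencil A B (max_ratio m A B x)"
  note r = max_ratio_between_0_1[OF m n pair x C]
  have Z: "Z_tensor m ?P" by (rule pencil_Z_tensor[OF m pair]) (use r in auto)
  show "(real (m - 1) *\<^sub>R tmat m ?P x) $ i $ j \<le> 0" if "i \<noteq> j" for i j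
    using Z_tensor_tmat_nonpos[OF m Z x that] by (simp add: mult_nonneg_nonpos)
  show "0 \<le> (real (m - 1) *\<^sub>R tmat m ?P x) *v x"
    using max_ratio_properties(1)[OF r(2), of A]
    by (simp add: less_eq_vec_def tmat_mult_self[OF m] flip: scaleR_matrix_vector_assoc)
  show "0 \<lless> (real (m - 1) *\<^sub>R tmat m ?P x) *v w" using r(2) by (subst w)
qed

lemma gnni_step_pos:
  assumes "0 \<lless> x" and "0 \<lless> y" and "0 < s"
  shows "0 \<lless> gnni_step m x y s"
  using assms by (auto simp: gnni_step_def vless_def add_nonneg_pos less_imp_le)

lemma normalize_pos:
  fixes x :: "real ^ 'n::finite"
  assumes "0 \<lless> x"
  shows "0 < norm x" and "0 \<lless> x /\<^sub>R norm x" and "norm (x /\<^sub>R norm x) = 1"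
proof -
  have "x \<noteq> 0" using assms by (auto simp: vless_def)
  then show "0 < norm x" "norm (x /\<^sub>R norm x) = 1" by simp_all
  then show "0 \<lless> x /\<^sub>R norm x" using assms by (simp add: vless_def)
qed

lemma gnni_invariant:
  fixes A B :: "'n::finite tensor" and x y w :: "nat \<Rightarrow> real ^ 'n"
  assumes m: "2 \<le> m" and n: "2 \<le> CARD('n)" and pair: "generalized_M_tensor_pair m A B"
    and gnni: "gnni m A B b \<rho> x w y \<theta>"
  shows "0 \<lless> x k \<and> norm (x k) = 1 \<and> 0 \<lless> tvec m (B - A) (x k)"
proof (induction k)
  have scale: "0 \<lless> tvec m (B - A) (z /\<^sub>R norm z)" if "0 \<lless> z" "0 \<lless> tvec m (B - A) z" for z
    using that normalize_pos(1)[OF that(1)] by (simp add: tvec_scaleR vless_def)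
  case 0
  obtain x' where x': "0 \<lless> x'" "0 \<lless> tvec m (B - A) x'" and x0: "x 0 = x' /\<^sub>R norm x'"
    using gnni unfolding gnni_def by blast
  show ?case unfolding x0 using scale[OF x'] normalize_pos[OF x'(1)] by blast
  case (Suc k)
  note g = gnni[unfolded gnni_def, THEN conjunct2, THEN conjunct2, rule_format, of k]
  let ?z = "gnni_step m (x k) (y k) (\<theta> k)"
  have "0 \<lless> w k" by (rule newton_direction_pos[OF m n pair, of "x k"]) (use Suc g in metis)+
  then have "0 \<lless> y k" using g normalize_pos(2) by simp
  then have "0 \<lless> ?z" using Suc g by (intro gnni_step_pos) auto
  then show ?case using g scale[of ?z] normalize_pos[of ?z] by metis
qed

text \<open>
  The step condition is read off at an index \<open>i\<close> where the maximum defining \<open>\<rho>\<^sub>k\<^sub>+\<^sub>1\<close> is attained: there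
  \<open>(\<rho>\<^sub>k B - A) x\<^sub>k\<^sub>+\<^sub>1\<^sup>m\<^sup>-\<^sup>1\<close> equals \<open>(\<rho>\<^sub>k - \<rho>\<^sub>k\<^sub>+\<^sub>1) B x\<^sub>k\<^sub>+\<^sub>1\<^sup>m\<^sup>-\<^sup>1\<close>. The factor \<open>N\<close> is the norm of the
  vector that is normalized to \<open>x\<^sub>k\<^sub>+\<^sub>1\<close>.
\<close>

lemma gnni_decrease_estimate:
  fixes A B :: "'n::finite tensor" and x y w :: "nat \<Rightarrow> real ^ 'n"
  assumes m: "2 \<le> m" and n: "2 \<le> CARD('n)" and pair: "generalized_M_tensor_pair m A B"
    and gnni: "gnni m A B b \<rho> x w y \<theta>"
    and h: "c *\<^sub>R tvec m B (x k) \<le> gnni_h m A B (\<rho> k) (x k) (y k) (\<theta> k)"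
  obtains i N where "0 < N" and "N \<le> real m"
    and "c * tvec m B (x k) $ i \<le> N ^ (m - 1) * ((\<rho> k - \<rho> (Suc k)) * tvec m B (x (Suc k)) $ i)"
proof -
  note g = gnni[unfolded gnni_def, THEN conjunct2, THEN conjunct2, rule_format]
  note inv = gnni_invariant[OF m n pair gnni]
  let ?z = "gnni_step m (x k) (y k) (\<theta> k)"
  have w: "0 \<lless> w k" by (rule newton_direction_pos[OF m n pair]) (use inv[of k] g[of k] in auto)
  then have y: "0 \<lless> y k" "norm (y k) = 1" using g[of k] normalize_pos[OF w] by simp_all
  have z: "0 \<lless> ?z" using y inv g[of k] by (intro gnni_step_pos) auto
  have zx: "?z = norm ?z *\<^sub>R x (Suc k)" using g[of k] normalize_pos(1)[OF z] by simp
  obtain i where i: "tvec m A (x (Suc k)) $ i = \<rho> (Suc k) * tvec m B (x (Suc k)) $ i"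
    using max_ratio_properties(2)[OF max_ratio_between_0_1(2)[OF m n pair]] inv[of "Suc k"] g[of "Suc k"]
    by metis
  show thesis
  proof (rule that)
    show "0 < norm ?z" by (rule normalize_pos(1)[OF z])
    have "norm (real (m - 2) *\<^sub>R x k) = real (m - 2)" using inv[of k] by simp
    moreover have "norm (\<theta> k *\<^sub>R y k) = \<theta> k"
      using y(2) g[of k] by (metis abs_of_pos mult.right_neutral norm_scaleR)
    ultimately have "norm ?z \<le> real (m - 2) + \<theta> k"
      unfolding gnni_step_def using norm_triangle_ineq[of "real (m - 2) *\<^sub>R x k" "\<theta> k *\<^sub>R y k"]
      by linarith
    then show "norm ?z \<le> real m" using g[of k] m by (simp add: of_nat_diff)
    have "c * tvec m B (x k) $ i \<le> tvec m (pencil A B (\<rho> k)) ?z $ i"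
      using h by (simp add: gnni_h_def less_eq_vec_def)
    also have "\<dots> = norm ?z ^ (m - 1) * tvec m (pencil A B (\<rho> k)) (x (Suc k)) $ i"
      by (subst zx) (simp add: tvec_scaleR)
    also have "tvec m (pencil A B (\<rho> k)) (x (Suc k)) $ i
        = (\<rho> k - \<rho> (Suc k)) * tvec m B (x (Suc k)) $ i"
      by (simp add: tvec_pencil i algebra_simps)
    finally show "c * tvec m B (x k) $ i
        \<le> norm ?z ^ (m - 1) * ((\<rho> k - \<rho> (Suc k)) * tvec m B (x (Suc k)) $ i)" .
  qed
qed

section \<open>Compactness bounds and limit points\<close>

lemma tvec_bounded_on_sphere:
  fixes B :: "'n::finite tensor"
  obtains K where "0 < K" and "\<And>x i. norm x = 1 \<Longrightarrow> tvec m B x $ i \<le> K"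
proof -
  have "continuous_on (sphere 0 1) (tvec m B)"
    unfolding continuous_on_def by (intro ballI tendsto_tvec tendsto_ident_at)
  then have "bounded (tvec m B ` sphere 0 1)"
    by (intro compact_imp_bounded compact_continuous_image) simp_all
  then obtain K where K: "0 < K" "\<And>x. norm x = 1 \<Longrightarrow> norm (tvec m B x) \<le> K"
    by (auto simp: bounded_pos)
  show thesis
  proof (rule that[OF K(1)])
    fix x :: "real ^ 'n" and i assume "norm x = 1"
    then show "tvec m B x $ i \<le> K"
      using K(2)[of x] component_le_norm_cart[of "tvec m B x" i] by linarith
  qed
qed

lemma compact_unique_limit_point:
  fixes X :: "nat \<Rightarrow> 'a::metric_space"
  assumes K: "compact K" "\<And>n. X n \<in> K"
    and unique: "\<And>r u. strict_mono r \<Longrightarrow> (X \<circ> r) \<longlonglongrightarrow> u \<Longrightarrow> u = l"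
  shows "X \<longlonglongrightarrow> l"
proof (rule ccontr)
  assume "\<not> X \<longlonglongrightarrow> l"
  then obtain e where e: "0 < e" "\<not> eventually (\<lambda>n. dist (X n) l < e) sequentially"
    by (auto simp: tendsto_iff)
  then have "infinite {n. e \<le> dist (X n) l}"
    by (simp add: not_eventually frequently_cofinite not_less flip: cofinite_eq_sequentially)
  then obtain r :: "nat \<Rightarrow> nat" where r: "strict_mono r" "\<And>n. e \<le> dist (X (r n)) l"
    using infinite_enumerate by blast
  obtain u q where q: "strict_mono q" "(X \<circ> r \<circ> q) \<longlonglongrightarrow> u"
    using K(1)[unfolded compact_def, rule_format, of "X \<circ> r"] K(2) by auto
  have "u = l" using unique[of "r \<circ> q" u] r(1) q by (simp add: strict_mono_o comp_assoc)
  then have "(\<lambda>n. dist ((X \<circ> r \<circ> q) n) l) \<longlonglongrightarrow> dist l l"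
    by (intro tendsto_dist tendsto_const) (use q(2) \<open>u = l\<close> in blast)
  then have "e \<le> dist l l"
    by (rule LIMSEQ_le_const) (use r(2) in auto)
  then show False using e(1) by simp
qed

text \<open>
  Passing to the limit in a Newton equation whose right-hand side tends to zero. In the limit \<open>z\<close>
  lies in the kernel of a matrix that maps \<open>u\<close> to a nonnegative vector, so that
  \<open>Z_matrix_kernel\<close> identifies \<open>z\<close> with \<open>u\<close>.
\<close>

lemma limit_point_is_eigenpair:
  fixes A B :: "'n::finite tensor"
  assumes m: "2 \<le> m" and pair: "generalized_M_tensor_pair m A B"
    and sym: "semisymmetric m A" "semisymmetric m B"
    and R: "R \<longlonglongrightarrow> lam" and lam: "0 \<le> lam" "lam < 1"
    and X: "X \<longlonglongrightarrow> u" and u: "0 \<lless> u" "norm u = 1"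
    and Y: "Y \<longlonglongrightarrow> z" and Y1: "\<And>k. 0 \<lless> Y k" "\<And>k. norm (Y k) = 1"
    and PX: "\<And>k. 0 \<le> tvec m (pencil A B (R k)) (X k)"
    and PY: "(\<lambda>k. tmat m (pencil A B (R k)) (X k) *v Y k) \<longlonglongrightarrow> 0"
  shows "z = u" and "tvec m A u = lam *\<^sub>R tvec m B u"
proof -
  let ?P = "pencil A B lam"
  have Z: "Z_tensor m ?P" by (rule pencil_Z_tensor[OF m pair]) (use lam in auto)
  have Pu: "0 \<le> tvec m ?P u"
  proof -
    have "(\<lambda>k. tvec m (pencil A B (R k)) (X k)) \<longlonglongrightarrow> tvec m ?P u"
      unfolding tvec_pencil by (intro tendsto_intros R X)
    then have lim: "(\<lambda>k. tvec m (pencil A B (R k)) (X k) $ i) \<longlonglongrightarrow> tvec m ?P u $ i" for i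
      by (rule tendsto_vec_nth)
    have "0 \<le> tvec m ?P u $ i" for i
      by (rule LIMSEQ_le_const[OF lim]) (use PX in \<open>auto simp: less_eq_vec_def\<close>)
    then show ?thesis by (simp add: less_eq_vec_def)
  qed
  have "(\<lambda>k. tmat m (pencil A B (R k)) (X k)) \<longlonglongrightarrow> tmat m ?P u"
    unfolding tmat_pencil by (intro tendsto_intros R X)
  then have "(\<lambda>k. tmat m (pencil A B (R k)) (X k) *v Y k) \<longlonglongrightarrow> tmat m ?P u *v z"
    unfolding matrix_vector_mult_def by (intro tendsto_intros Y)
  then have Mz: "tmat m ?P u *v z = 0" using PY LIMSEQ_unique by blast
  have z0: "0 \<le> z"
  proof -
    have "0 \<le> z $ i" for i
      by (rule LIMSEQ_le_const[OF tendsto_vec_nth[OF Y]]) (use Y1(1) in \<open>auto simp: vless_def less_imp_le\<close>)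
    then show ?thesis by (simp add: less_eq_vec_def)
  qed
  have "(\<lambda>k. norm (Y k)) \<longlonglongrightarrow> norm z" by (intro tendsto_intros Y)
  then have z1: "norm z = 1" using Y1(2) by (simp add: LIMSEQ_const_iff)
  have "irreducible_matrix (tmat m ?P u)"
    by (rule Z_tensor_tmat_irreducible[OF m Z pencil_weakly_irreducible[OF m pair lam]
          semisymmetric_pencil[OF sym] u(1)])
  from Z_matrix_kernel[OF Z_tensor_tmat_nonpos[OF m Z u(1)] this u(1) _ z0 Mz]
  obtain t where t: "0 \<le> t" "z = t *\<^sub>R u" using Pu by (metis tmat_mult_self[OF m])
  show zu: "z = u" using t z1 u(2) by simp
  show "tvec m A u = lam *\<^sub>R tvec m B u"
    using Mz by (simp add: zu tmat_mult_self[OF m] tvec_pencil)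
qed

theorem theorem4p5:
  fixes m :: nat and A B :: "'n::finite tensor" and b :: "real ^ 'n"
    and \<rho> \<theta> :: "nat \<Rightarrow> real" and x w y :: "nat \<Rightarrow> real ^ 'n" and \<eta> \<xi> :: real
  assumes "2 \<le> m" and "2 \<le> CARD('n)"
    and "semisymmetric m A" and "semisymmetric m B"
    and "generalized_M_tensor_pair m A B"
    and "gnni m A B b \<rho> x w y \<theta>"
    and "0 < \<eta>" and "0 < \<xi>"
    and "\<And>k. \<theta> k \<in> {\<xi>..1}"
    and "\<And>k. (\<theta> k / ((1 + \<eta>) * norm (w k))) *\<^sub>R tvec m B (x k)
                \<le> gnni_h m A B (\<rho> k) (x k) (y k) (\<theta> k)"
  shows "\<exists>lam xs.
    0 < lam \<and> generalized_eigenpair m A B lam xs \<and> 0 \<lless> xs \<and> norm xs = 1 \<and>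
    (\<forall>\<mu> v. 0 < \<mu> \<and> 0 \<lless> v \<and> generalized_eigenpair m A B \<mu> v \<longrightarrow> \<mu> = lam) \<and>
    (\<forall>v. 0 \<lless> v \<and> norm v = 1 \<and> generalized_eigenpair m A B lam v \<longrightarrow> v = xs) \<and>
    (\<forall>k. \<rho> (Suc k) < \<rho> k) \<and>
    \<rho> \<longlonglongrightarrow> lam \<and> x \<longlonglongrightarrow> xs \<and> y \<longlonglongrightarrow> xs"
proof -
  note m = assms(1) and n = assms(2) and pair = assms(5) and gnni = assms(6)
  note g = gnni[unfolded gnni_def, THEN conjunct2, THEN conjunct2, rule_format]
  have xp: "0 \<lless> x k" and x1: "norm (x k) = 1" and xC: "0 \<lless> tvec m (B - A) (x k)" for k
    using gnni_invariant[OF m n pair gnni, of k] by metis+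
  have \<rho>: "\<rho> k = max_ratio m A B (x k)" for k using g[of k] by metis
  note ratio = max_ratio_between_0_1[OF m n pair xp xC, folded \<rho>]
  have w: "0 \<lless> w k" for k
    by (rule newton_direction_pos[OF m n pair xp[of k] xC[of k]]) (use g[of k] in metis)
  have yw: "y k = w k /\<^sub>R norm (w k)" for k using g[of k] by metis
  then have y: "0 \<lless> y k" "norm (y k) = 1" for k using normalize_pos[OF w[of k]] by simp_all
  have P\<rho>: "0 \<le> tvec m (pencil A B (\<rho> k)) (x k)" for k
    using max_ratio_properties(1)[OF ratio(2)] by (simp add: \<rho>)
  define c where "c k = \<theta> k / ((1 + \<eta>) * norm (w k))" for k
  have c: "0 < c k" for k
    unfolding c_def using assms(7,8) assms(9)[of k] normalize_pos(1)[OF w[of k]]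
    by (intro divide_pos_pos mult_pos_pos) auto
  note est = gnni_decrease_estimate[OF m n pair gnni assms(10), folded c_def]

  have decr: "\<rho> (Suc k) < \<rho> k" for k
  proof -
    obtain i N where N: "0 < N" "c k * tvec m B (x k) $ i
        \<le> N ^ (m - 1) * ((\<rho> k - \<rho> (Suc k)) * tvec m B (x (Suc k)) $ i)"
      by (rule est[of k]) blast
    have "0 < c k * tvec m B (x k) $ i" using c ratio(2)[of k] by (simp add: vless_def)
    then have "0 < N ^ (m - 1) * ((\<rho> k - \<rho> (Suc k)) * tvec m B (x (Suc k)) $ i)"
      using N(2) by linarith
    then show ?thesis
      using N(1) ratio(2)[of "Suc k"] by (auto simp: vless_def zero_less_mult_iff dest: less_asym)
  qed
  then have "decseq \<rho>" by (intro decseq_SucI less_imp_le)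
  then obtain lam where lam: "\<rho> \<longlonglongrightarrow> lam" "\<And>k. lam \<le> \<rho> k"
    using decseq_convergent[of \<rho> 0] ratio(3) less_imp_le by metis
  have lam0: "0 \<le> lam" by (rule LIMSEQ_le_const[OF lam(1)]) (use ratio(3) less_imp_le in blast)
  have lam1: "lam < 1" using lam(2)[of 0] ratio(4)[of 0] by linarith

  \<comment> \<open>A unit vector has \<open>l\<^sub>1\<close>-norm at least 1; as its entries are at most \<open>K x\<^sub>j\<close>, every \<open>x\<^sub>j\<close> is
    at least \<open>\<delta>\<close>.\<close>
  obtain K where K: "0 < K" and har: "\<And>r x i j. \<lbrakk>0 \<le> r; r \<le> \<rho> 0; 0 \<lless> x;
      0 \<le> tvec m (pencil A B r) x\<rbrakk> \<Longrightarrow> x $ i \<le> K * x $ j"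
    by (rule pencil_harnack[OF m pair ratio(4)[of 0]]) blast
  define \<delta> where "\<delta> = 1 / (real CARD('n) * K)"
  have \<delta>: "0 < \<delta>" using K by (simp add: \<delta>_def)
  have x\<delta>: "\<delta> \<le> x k $ j" for k j
  proof -
    have "1 = norm (x k)" using x1 by simp
    also have "\<dots> \<le> (\<Sum>i\<in>UNIV. \<bar>x k $ i\<bar>)" by (rule norm_le_l1_cart)
    also have "\<dots> \<le> (\<Sum>i\<in>(UNIV :: 'n set). K * x k $ j)"
    proof (rule sum_mono)
      fix i
      have "\<rho> k \<le> \<rho> 0" using \<open>decseq \<rho>\<close> by (simp add: decseq_def)
      then have "x k $ i \<le> K * x k $ j"
        using ratio(3)[of k] xp[of k] P\<rho>[of k] by (intro har) auto
      then show "\<bar>x k $ i\<bar> \<le> K * x k $ j" using xp[of k] by (simp add: vless_def abs_of_pos)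
    qed
    finally have "1 \<le> real CARD('n) * K * x k $ j" by (simp add: mult.assoc)
    then show ?thesis using K by (simp add: \<delta>_def field_simps)
  qed

  \<comment> \<open>\<open>B x\<^sub>k\<^sup>m\<^sup>-\<^sup>1 > A x\<^sub>k\<^sup>m\<^sup>-\<^sup>1\<close>, and the latter is monotone in \<open>x\<^sub>k\<close>, so its value at the constant vector
    \<open>\<delta>\<close> is a uniform lower bound.\<close>
  define \<epsilon> where "\<epsilon> = Min (range (\<lambda>i. tvec m A (\<chi> j. \<delta>) $ i))"
  have A: "\<forall>is. length is = m \<longrightarrow> 0 \<le> A is" and irr: "weakly_irreducible m A"
    using pair by (simp_all add: generalized_M_tensor_pair_def)
  have \<epsilon>: "0 < \<epsilon>"
    using tvec_pos_weakly_irreducible[OF m n A irr, of "\<chi> j. \<delta>"] \<delta>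
    by (simp add: \<epsilon>_def vless_def)
  have B\<epsilon>: "\<epsilon> \<le> tvec m B (x k) $ i" for k i
  proof -
    have "\<epsilon> \<le> tvec m A (\<chi> j. \<delta>) $ i" unfolding \<epsilon>_def by (rule Min_le) auto
    also have "\<dots> \<le> tvec m A (x k) $ i"
      by (rule tvec_mono_nonneg_tensor[OF m A]) (use \<delta> x\<delta> in auto)
    also have "\<dots> \<le> tvec m B (x k) $ i"
      using xC[of k, unfolded tvec_diff] by (simp add: vless_def less_imp_le)
    finally show ?thesis .
  qed
  obtain L where L: "0 < L" "\<And>x i. norm x = 1 \<Longrightarrow> tvec m B x $ i \<le> L"
    by (rule tvec_bounded_on_sphere[of m B]) blast
  \<comment> \<open>The first factor undoes \<open>c\<^sub>k \<ge> \<xi> / ((1 + \<eta>) \<parallel>w\<^sub>k\<parallel>)\<close>; the second is the decrease estimate with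
    \<open>B\<close> bounded below by \<open>\<epsilon>\<close> at \<open>x\<^sub>k\<close> and above by \<open>L\<close> at \<open>x\<^sub>k\<^sub>+\<^sub>1\<close>.\<close>
  define D where "D = (1 + \<eta>) / \<xi> * (real m ^ (m - 1) * L / \<epsilon>)"
  have inv_w: "inverse (norm (w k)) \<le> D * (\<rho> k - \<rho> (Suc k))" for k
  proof -
    obtain i N where N: "0 < N" "N \<le> real m" "c k * tvec m B (x k) $ i
        \<le> N ^ (m - 1) * ((\<rho> k - \<rho> (Suc k)) * tvec m B (x (Suc k)) $ i)"
      by (rule est[of k]) blast
    have "c k * \<epsilon> \<le> c k * tvec m B (x k) $ i"
      using c[of k] B\<epsilon> by (intro mult_left_mono) auto
    also note N(3)
    also have "N ^ (m - 1) * ((\<rho> k - \<rho> (Suc k)) * tvec m B (x (Suc k)) $ i)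
        \<le> real m ^ (m - 1) * ((\<rho> k - \<rho> (Suc k)) * L)"
    proof (intro mult_mono power_mono L(2))
      show "0 \<le> (\<rho> k - \<rho> (Suc k)) * tvec m B (x (Suc k)) $ i"
        using decr[of k] ratio(2)[of "Suc k"] by (simp add: vless_def less_imp_le)
      show "0 \<le> tvec m B (x (Suc k)) $ i"
        using ratio(2)[of "Suc k"] by (simp add: vless_def less_imp_le)
    qed (use N decr[of k] x1 in auto)
    finally have "c k \<le> real m ^ (m - 1) * L / \<epsilon> * (\<rho> k - \<rho> (Suc k))"
      using \<epsilon> by (simp add: field_simps)
    then have "(1 + \<eta>) / \<xi> * c k
        \<le> (1 + \<eta>) / \<xi> * (real m ^ (m - 1) * L / \<epsilon> * (\<rho> k - \<rho> (Suc k)))"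
      by (rule mult_left_mono) (use assms(7,8) in simp)
    then have "(1 + \<eta>) / \<xi> * c k \<le> D * (\<rho> k - \<rho> (Suc k))"
      unfolding D_def by (simp only: mult.assoc)
    moreover have "inverse (norm (w k)) \<le> (1 + \<eta>) / \<xi> * c k"
    proof -
      have "(1 + \<eta>) / \<xi> * c k = \<theta> k / \<xi> * inverse (norm (w k))"
        using assms(7) by (simp add: c_def divide_simps)
      moreover have "1 * inverse (norm (w k)) \<le> \<theta> k / \<xi> * inverse (norm (w k))"
        using assms(8) assms(9)[of k] by (intro mult_right_mono) auto
      ultimately show ?thesis by (metis mult_1)
    qed
    ultimately show ?thesis by linarith
  qed
  have w_lim: "(\<lambda>k. inverse (norm (w k))) \<longlonglongrightarrow> 0"
  proof (rule tendsto_sandwich[OF _ _ tendsto_const])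
    show "\<forall>\<^sub>F k in sequentially. inverse (norm (w k)) \<le> D * (\<rho> k - \<rho> (Suc k))"
      using inv_w by simp
    have "(\<lambda>k. D * (\<rho> k - \<rho> (Suc k))) \<longlonglongrightarrow> D * (lam - lam)"
      by (intro tendsto_intros lam(1) LIMSEQ_Suc)
    then show "(\<lambda>k. D * (\<rho> k - \<rho> (Suc k))) \<longlonglongrightarrow> 0" by simp
  qed simp

  have newton: "tmat m (pencil A B (\<rho> k)) (x k) *v y k
      = (inverse (norm (w k)) / real (m - 1)) *\<^sub>R tvec m B (x k)" for k
  proof -
    let ?M = "tmat m (pencil A B (\<rho> k)) (x k)"
    have "(real (m - 1) *\<^sub>R ?M) *v w k = tvec m B (x k)" using g[of k] by blast
    then have "tvec m B (x k) = real (m - 1) *\<^sub>R (?M *v w k)"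
      by (simp only: scaleR_matrix_vector_assoc)
    moreover have "real (m - 1) \<noteq> 0" using m by simp
    ultimately show ?thesis by (simp add: yw matrix_vector_mult_scaleR)
  qed
  have cluster: "z = u \<and> 0 \<lless> u \<and> norm u = 1 \<and> tvec m A u = lam *\<^sub>R tvec m B u \<and> 0 < lam"
    if r: "strict_mono r" and X: "(x \<circ> r) \<longlonglongrightarrow> u" and Y: "(y \<circ> r) \<longlonglongrightarrow> z" for r u z
  proof -
    have "\<delta> \<le> u $ j" for j
      by (rule LIMSEQ_le_const[OF tendsto_vec_nth[OF X]]) (use x\<delta> in auto)
    then have u: "0 \<lless> u" using \<delta> unfolding vless_def by (metis less_le_trans zero_index)
    have "(\<lambda>k. norm ((x \<circ> r) k)) \<longlonglongrightarrow> norm u" by (intro tendsto_intros X)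
    then have u1: "norm u = 1" using x1 by (simp add: LIMSEQ_const_iff)
    have R: "(\<rho> \<circ> r) \<longlonglongrightarrow> lam" by (rule LIMSEQ_subseq_LIMSEQ[OF lam(1) r])
    have W: "(\<lambda>k. inverse (norm (w (r k)))) \<longlonglongrightarrow> 0"
      using LIMSEQ_subseq_LIMSEQ[OF w_lim r] by (simp add: o_def)
    have "(\<lambda>k. (inverse (norm (w (r k))) * inverse (real (m - 1))) *\<^sub>R tvec m B ((x \<circ> r) k))
        \<longlonglongrightarrow> (0 * inverse (real (m - 1))) *\<^sub>R tvec m B u"
      by (intro tendsto_intros W X)
    then have PY: "(\<lambda>k. tmat m (pencil A B ((\<rho> \<circ> r) k)) ((x \<circ> r) k) *v (y \<circ> r) k) \<longlonglongrightarrow> 0"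
      by (simp add: newton divide_inverse)
    have eig: "z = u" "tvec m A u = lam *\<^sub>R tvec m B u"
      using limit_point_is_eigenpair[OF m pair assms(3,4) R lam0 lam1 X u u1 Y _ _ _ PY] y P\<rho>
      by simp_all
    have "0 \<lless> tvec m A u" by (rule tvec_pos_weakly_irreducible[OF m n A irr u])
    then have "lam \<noteq> 0" using eig(2) by (auto simp: vless_def)
    then show ?thesis using eig u u1 lam0 by simp
  qed
  \<comment> \<open>The pairs \<open>(x\<^sub>k, y\<^sub>k)\<close> are treated as one sequence, so that a single subsequence serves both.\<close>
  let ?S = "sphere 0 1 \<times> sphere 0 1 :: ((real ^ 'n) \<times> (real ^ 'n)) set"
  have comp: "compact ?S" and in_S: "(x k, y k) \<in> ?S" for k
    using x1 y by (simp_all add: compact_Times)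
  have limit_pair: "snd p = fst p \<and> 0 \<lless> fst p \<and> norm (fst p) = 1 \<and>
      tvec m A (fst p) = lam *\<^sub>R tvec m B (fst p) \<and> 0 < lam"
    if "strict_mono r" "((\<lambda>k. (x k, y k)) \<circ> r) \<longlonglongrightarrow> p" for r p
    using cluster[OF that(1), of "fst p" "snd p"] tendsto_fst[OF that(2)] tendsto_snd[OF that(2)]
    by (simp add: o_def)
  obtain p r where r: "strict_mono r" and p: "((\<lambda>k. (x k, y k)) \<circ> r) \<longlonglongrightarrow> p"
    using comp[unfolded compact_def, rule_format, of "\<lambda>k. (x k, y k)"] in_S by blast
  define xs where "xs = fst p"
  have xs: "0 \<lless> xs" "norm xs = 1" "tvec m A xs = lam *\<^sub>R tvec m B xs" and lam_pos: "0 < lam"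
    using limit_pair[OF r p] by (simp_all add: xs_def)
  note unique = positive_eigenpair_unique[OF m pair n xs(1,3) lam_pos]
  have "(\<lambda>k. (x k, y k)) \<longlonglongrightarrow> (xs, xs)"
  proof (rule compact_unique_limit_point[OF comp in_S])
    fix r p assume "strict_mono r" "((\<lambda>k. (x k, y k)) \<circ> r) \<longlonglongrightarrow> p"
    then have p: "snd p = fst p" "0 \<lless> fst p" "norm (fst p) = 1"
      "tvec m A (fst p) = lam *\<^sub>R tvec m B (fst p)" using limit_pair by blast+
    then have "fst p = xs" using unique(2)[OF p(2,4) lam_pos xs(2)] by simp
    then show "p = (xs, xs)" using p(1) by (simp add: prod_eq_iff)
  qed
  then have lims: "x \<longlonglongrightarrow> xs" "y \<longlonglongrightarrow> xs"
    using tendsto_fst tendsto_snd by fastforce+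
  have "xs \<noteq> 0" using xs(2) by auto
  then have "generalized_eigenpair m A B lam xs" using xs(3) by (simp add: generalized_eigenpair_def)
  moreover have "\<forall>\<mu> v. 0 < \<mu> \<and> 0 \<lless> v \<and> generalized_eigenpair m A B \<mu> v \<longrightarrow> \<mu> = lam"
    using unique(1) by (auto simp: generalized_eigenpair_def)
  moreover have "\<forall>v. 0 \<lless> v \<and> norm v = 1 \<and> generalized_eigenpair m A B lam v \<longrightarrow> v = xs"
    using unique(2)[OF _ _ lam_pos xs(2)] by (auto simp: generalized_eigenpair_def)
  ultimately show ?thesis
    using lam_pos xs(1,2) decr lam(1) lims by blast
qed

end
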